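(* Let $\mathcal{V}=(\underline{\mathrm{Sets}},\times,\{*\})$ be the monoidal category of sets. Then a Hopf $\mathcal{V}$-category is the same thing as a groupoid. That is, identifying $\mathcal{C}(\underline{\mathrm{Sets}})$-categories with ordinary categories as explained in the context, Hopf $\underline{\mathrm{Sets}}$-categories correspond exactly to the categories in which every morphism is invertible.
   Context: Let $(\mathcal{V},\otimes,k,c)$ be a strict braided monoidal category (results being applied to non-strict ones by suppressing associativity and unit isomorphisms). A $\mathcal{V}$-category $A$ consists of a class $X$, objects $A_{x,y}$ of $\mathcal{V}$ ($x,y\in X$), and morphisms $m_{x,y,z}:A_{x,y}\otimes A_{y,z}\to A_{x,z}$ and $\eta_x:k\to A_{x,x}$ in $\mathcal V$ which satisfy the associativity condition $m_{x,y,t}\circ(\mathrm{id}\otimes m_{y,z,t})=m_{x,z,t}\circ(m_{x,y,z}\otimes \mathrm{id})$ and the unit conditions $m_{x,x,y}\circ(\eta_x\otimes \mathrm{id})=\mathrm{id}=m_{x,y,y}\circ(\mathrm{id}\otimes\eta_y)$. A $\underline{\mathrm{Sets}}$-category is an ordinary category with class of objects $X$ via $\mathrm{Hom}(x,y)=A_{y,x}$, composition $b\circ a=m_{z,y,x}(b,a)$ for $a\in A_{y,x}$, $b\in A_{z,y}$, and identities $\eta_x( * )$. $\mathcal{C}(\mathcal{V})$ is the monoidal category of coalgebras (comonoids) in $\mathcal V$. A $\mathcal{C}(\mathcal V)$-category is a category enriched in $\mathcal{C}(\mathcal V)$: each $A_{x,y}$ is a coalgebra with comultiplication $\Delta_{x,y}$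 and counit $\varepsilon_{x,y}$, and all $m_{x,y,z}$ and $\eta_x$ are coalgebra morphisms. A Hopf $\mathcal V$-category is a $\mathcal{C}(\mathcal V)$-category $A$ together with morphisms $S_{x,y}:A_{x,y}\to A_{y,x}$ in $\mathcal V$ such that, for all $x,y\in X$, $$m_{x,y,x}\circ(\mathrm{id}\otimes S_{x,y})\circ\Delta_{x,y}=\eta_x\circ\varepsilon_{x,y},\qquad m_{y,x,y}\circ(S_{x,y}\otimes \mathrm{id})\circ\Delta_{x,y}=\eta_y\circ\varepsilon_{x,y}.$$ Every set $G$ has a unique coalgebra structure in $\underline{\mathrm{Sets}}$ (comultiplication $g\mapsto(g,g)$, counit the unique map $G\to\{*\}$), so $\mathcal{C}(\underline{\mathrm{Sets}})=\underline{\mathrm{Sets}}$ and $\mathcal{C}(\underline{\mathrm{Sets}})$-categories are ordinary categories. A groupoid is a category in which every morphism is invertible. *)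

theory Defs
  imports "HOL-Library.FuncSet"
begin

section \<open>Braided monoidal categories\<close>

text \<open>
  A category has a set of objects and a set of arrows, and every arrow knows its domain and its
  codomain.  The cartesian product of sets is not strictly associative or unital, so the
  associativity and unit isomorphisms, suppressed in informal writing, are kept explicit.
\<close>

record ('o, 'm) braided_cat =
  Obj :: "'o set"
  Arr :: "'m set"
  Dom :: "'m \<Rightarrow> 'o"
  Cod :: "'m \<Rightarrow> 'o"
  Id :: "'o \<Rightarrow> 'm" ("\<one>\<index>")
  Cmp :: "'m \<Rightarrow> 'm \<Rightarrow> 'm" (infixr "\<cdot>\<index>" 65)
  TenO :: "'o \<Rightarrow> 'o \<Rightarrow> 'o" (infixr "\<otimes>\<index>" 75)
  TenA :: "'m \<Rightarrow> 'm \<Rightarrow> 'm" (infixr "\<odot>\<index>" 75)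
  UnitO :: "'o" ("\<k>\<index>")
  Assoc :: "'o \<Rightarrow> 'o \<Rightarrow> 'o \<Rightarrow> 'm" ("\<a>\<index>")
  LUnit :: "'o \<Rightarrow> 'm" ("\<l>\<index>")
  RUnit :: "'o \<Rightarrow> 'm" ("\<r>\<index>")
  Braid :: "'o \<Rightarrow> 'o \<Rightarrow> 'm" ("\<c>\<index>")

definition homs :: "('o, 'm) braided_cat \<Rightarrow> 'o \<Rightarrow> 'o \<Rightarrow> 'm set"
  where "homs V A B = {f \<in> Arr V. Dom V f = A \<and> Cod V f = B}"

definition inverse_arrows :: "('o, 'm) braided_cat \<Rightarrow> 'm \<Rightarrow> 'm \<Rightarrow> bool"
  where "inverse_arrows V f g \<longleftrightarrow>
    f \<in> Arr V \<and> g \<in> homs V (Cod V f) (Dom V f) \<and>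
    g \<cdot>\<^bsub>V\<^esub> f = \<one>\<^bsub>V\<^esub> (Dom V f) \<and> f \<cdot>\<^bsub>V\<^esub> g = \<one>\<^bsub>V\<^esub> (Cod V f)"

definition isos :: "('o, 'm) braided_cat \<Rightarrow> 'o \<Rightarrow> 'o \<Rightarrow> 'm set"
  where "isos V A B = {f \<in> homs V A B. \<exists>g. inverse_arrows V f g}"

definition Inv :: "('o, 'm) braided_cat \<Rightarrow> 'm \<Rightarrow> 'm"
  where "Inv V f = (THE g. inverse_arrows V f g)"

locale category_axms =
  fixes V :: "('o, 'm) braided_cat" (structure)
  assumes dom_cod: "f \<in> Arr V \<Longrightarrow> Dom V f \<in> Obj V \<and> Cod V f \<in> Obj V"
    and id_hom: "A \<in> Obj V \<Longrightarrow> \<one> A \<in> homs V A A"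
    and cmp_hom: "\<lbrakk>f \<in> homs V A B; g \<in> homs V B C\<rbrakk> \<Longrightarrow> g \<cdot> f \<in> homs V A C"
    and cmp_id: "f \<in> homs V A B \<Longrightarrow> f \<cdot> \<one> A = f"
    and id_cmp: "f \<in> homs V A B \<Longrightarrow> \<one> B \<cdot> f = f"
    and cmp_assoc: "\<lbrakk>f \<in> homs V A B; g \<in> homs V B C; h \<in> homs V C D\<rbrakk>
      \<Longrightarrow> (h \<cdot> g) \<cdot> f = h \<cdot> (g \<cdot> f)"

locale monoidal_category = category_axms +
  assumes ten_obj: "\<lbrakk>A \<in> Obj V; B \<in> Obj V\<rbrakk> \<Longrightarrow> A \<otimes> B \<in> Obj V"
    and ten_hom: "\<lbrakk>f \<in> homs V A B; g \<in> homs V C D\<rbrakk> \<Longrightarrow> f \<odot> g \<in> homs V (A \<otimes> C) (B \<otimes> D)"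
    and ten_id: "\<lbrakk>A \<in> Obj V; B \<in> Obj V\<rbrakk> \<Longrightarrow> \<one> A \<odot> \<one> B = \<one> (A \<otimes> B)"
    and ten_cmp: "\<lbrakk>f \<in> homs V A B; g \<in> homs V B C; f' \<in> homs V A' B'; g' \<in> homs V B' C'\<rbrakk>
      \<Longrightarrow> (g \<cdot> f) \<odot> (g' \<cdot> f') = (g \<odot> g') \<cdot> (f \<odot> f')"
    and unit_obj: "\<k> \<in> Obj V"
    and assoc_iso: "\<lbrakk>A \<in> Obj V; B \<in> Obj V; C \<in> Obj V\<rbrakk>
      \<Longrightarrow> \<a> A B C \<in> isos V ((A \<otimes> B) \<otimes> C) (A \<otimes> (B \<otimes> C))"
    and lunit_iso: "A \<in> Obj V \<Longrightarrow> \<l> A \<in> isos V (\<k> \<otimes> A) A"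
    and runit_iso: "A \<in> Obj V \<Longrightarrow> \<r> A \<in> isos V (A \<otimes> \<k>) A"
    and assoc_nat: "\<lbrakk>f \<in> homs V A A'; g \<in> homs V B B'; h \<in> homs V C C'\<rbrakk>
      \<Longrightarrow> \<a> A' B' C' \<cdot> ((f \<odot> g) \<odot> h) = (f \<odot> (g \<odot> h)) \<cdot> \<a> A B C"
    and lunit_nat: "f \<in> homs V A B \<Longrightarrow> \<l> B \<cdot> (\<one> \<k> \<odot> f) = f \<cdot> \<l> A"
    and runit_nat: "f \<in> homs V A B \<Longrightarrow> \<r> B \<cdot> (f \<odot> \<one> \<k>) = f \<cdot> \<r> A"
    and pentagon: "\<lbrakk>A \<in> Obj V; B \<in> Obj V; C \<in> Obj V; D \<in> Obj V\<rbrakk>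
      \<Longrightarrow> (\<one> A \<odot> \<a> B C D) \<cdot> \<a> A (B \<otimes> C) D \<cdot> (\<a> A B C \<odot> \<one> D)
        = \<a> A B (C \<otimes> D) \<cdot> \<a> (A \<otimes> B) C D"
    and triangle: "\<lbrakk>A \<in> Obj V; B \<in> Obj V\<rbrakk> \<Longrightarrow> (\<one> A \<odot> \<l> B) \<cdot> \<a> A \<k> B = \<r> A \<odot> \<one> B"

locale braided_monoidal_category = monoidal_category +
  assumes braid_iso: "\<lbrakk>A \<in> Obj V; B \<in> Obj V\<rbrakk> \<Longrightarrow> \<c> A B \<in> isos V (A \<otimes> B) (B \<otimes> A)"
    and braid_nat: "\<lbrakk>f \<in> homs V A A'; g \<in> homs V B B'\<rbrakk>
      \<Longrightarrow> \<c> A' B' \<cdot> (f \<odot> g) = (g \<odot> f) \<cdot> \<c> A B"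
    and hexagon1: "\<lbrakk>A \<in> Obj V; B \<in> Obj V; C \<in> Obj V\<rbrakk>
      \<Longrightarrow> \<a> B C A \<cdot> \<c> A (B \<otimes> C) \<cdot> \<a> A B C
        = (\<one> B \<odot> \<c> A C) \<cdot> \<a> B A C \<cdot> (\<c> A B \<odot> \<one> C)"
    and hexagon2: "\<lbrakk>A \<in> Obj V; B \<in> Obj V; C \<in> Obj V\<rbrakk>
      \<Longrightarrow> Inv V (\<a> C A B) \<cdot> \<c> (A \<otimes> B) C \<cdot> Inv V (\<a> A B C)
        = (\<c> A C \<odot> \<one> B) \<cdot> Inv V (\<a> A C B) \<cdot> (\<one> A \<odot> \<c> B C)"


section \<open>Coalgebras\<close>

locale coalgebra = monoidal_category +
  fixes C \<Delta> \<epsilon>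
  assumes carrier_obj: "C \<in> Obj V"
    and comult_hom: "\<Delta> \<in> homs V C (C \<otimes> C)"
    and counit_hom: "\<epsilon> \<in> homs V C \<k>"
    and coassoc: "\<a> C C C \<cdot> (\<Delta> \<odot> \<one> C) \<cdot> \<Delta> = (\<one> C \<odot> \<Delta>) \<cdot> \<Delta>"
    and lcounit: "\<l> C \<cdot> (\<epsilon> \<odot> \<one> C) \<cdot> \<Delta> = \<one> C"
    and rcounit: "\<r> C \<cdot> (\<one> C \<odot> \<epsilon>) \<cdot> \<Delta> = \<one> C"

definition coalgebra_morphism ::
    "('o, 'm) braided_cat \<Rightarrow> 'o \<Rightarrow> 'm \<Rightarrow> 'm \<Rightarrow> 'o \<Rightarrow> 'm \<Rightarrow> 'm \<Rightarrow> 'm \<Rightarrow> bool"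
  where "coalgebra_morphism V C \<Delta> \<epsilon> D \<Delta>' \<epsilon>' f \<longleftrightarrow>
    f \<in> homs V C D \<and> \<Delta>' \<cdot>\<^bsub>V\<^esub> f = (f \<odot>\<^bsub>V\<^esub> f) \<cdot>\<^bsub>V\<^esub> \<Delta> \<and> \<epsilon>' \<cdot>\<^bsub>V\<^esub> f = \<epsilon>"

text \<open>
  The arrow \<open>(A \<otimes> B) \<otimes> (C \<otimes> D) \<rightarrow> (A \<otimes> C) \<otimes> (B \<otimes> D)\<close> that braids the two middle factors;
  in a strict category it is \<open>\<one> \<otimes> \<c> \<otimes> \<one>\<close>.
\<close>

definition interchange :: "('o, 'm) braided_cat \<Rightarrow> 'o \<Rightarrow> 'o \<Rightarrow> 'o \<Rightarrow> 'o \<Rightarrow> 'm"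
  where "interchange V A B C D =
    Inv V (\<a>\<^bsub>V\<^esub> A C (B \<otimes>\<^bsub>V\<^esub> D))
    \<cdot>\<^bsub>V\<^esub> (\<one>\<^bsub>V\<^esub> A \<odot>\<^bsub>V\<^esub> \<a>\<^bsub>V\<^esub> C B D)
    \<cdot>\<^bsub>V\<^esub> (\<one>\<^bsub>V\<^esub> A \<odot>\<^bsub>V\<^esub> (\<c>\<^bsub>V\<^esub> B C \<odot>\<^bsub>V\<^esub> \<one>\<^bsub>V\<^esub> D))
    \<cdot>\<^bsub>V\<^esub> (\<one>\<^bsub>V\<^esub> A \<odot>\<^bsub>V\<^esub> Inv V (\<a>\<^bsub>V\<^esub> B C D))
    \<cdot>\<^bsub>V\<^esub> \<a>\<^bsub>V\<^esub> A B (C \<otimes>\<^bsub>V\<^esub> D)"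

text \<open>The coalgebra structures of a tensor product of coalgebras and of the unit object.\<close>

definition tensor_comult :: "('o, 'm) braided_cat \<Rightarrow> 'o \<Rightarrow> 'm \<Rightarrow> 'o \<Rightarrow> 'm \<Rightarrow> 'm"
  where "tensor_comult V C \<Delta> D \<Delta>' = interchange V C C D D \<cdot>\<^bsub>V\<^esub> (\<Delta> \<odot>\<^bsub>V\<^esub> \<Delta>')"

definition tensor_counit :: "('o, 'm) braided_cat \<Rightarrow> 'm \<Rightarrow> 'm \<Rightarrow> 'm"
  where "tensor_counit V \<epsilon> \<epsilon>' = \<l>\<^bsub>V\<^esub> \<k>\<^bsub>V\<^esub> \<cdot>\<^bsub>V\<^esub> (\<epsilon> \<odot>\<^bsub>V\<^esub> \<epsilon>')"

definition unit_comult :: "('o, 'm) braided_cat \<Rightarrow> 'm"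
  where "unit_comult V = Inv V (\<l>\<^bsub>V\<^esub> \<k>\<^bsub>V\<^esub>)"

definition unit_counit :: "('o, 'm) braided_cat \<Rightarrow> 'm"
  where "unit_counit V = \<one>\<^bsub>V\<^esub> \<k>\<^bsub>V\<^esub>"


section \<open>Enriched categories and Hopf categories\<close>

record ('x, 'o, 'm) enriched_data =
  Pts :: "'x set"
  HomO :: "'x \<Rightarrow> 'x \<Rightarrow> 'o"
  Mult :: "'x \<Rightarrow> 'x \<Rightarrow> 'x \<Rightarrow> 'm"
  Eta :: "'x \<Rightarrow> 'm"

record ('x, 'o, 'm) coalg_enriched_data = "('x, 'o, 'm) enriched_data" +
  Comult :: "'x \<Rightarrow> 'x \<Rightarrow> 'm"
  Counit :: "'x \<Rightarrow> 'x \<Rightarrow> 'm"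

record ('x, 'o, 'm) hopf_data = "('x, 'o, 'm) coalg_enriched_data" +
  Antipode :: "'x \<Rightarrow> 'x \<Rightarrow> 'm"

text \<open>
  The class of objects \<open>X\<close> is a subset of a type, while the families indexed by \<open>X\<close> are total
  functions.  The assumptions named \<open>_ext\<close> fix their irrelevant values outside \<open>X\<close>, so that
  equality of the records is equality of the families indexed by \<open>X\<close>.
\<close>

locale enriched_category = monoidal_category V for V :: "('o, 'm) braided_cat" (structure) +
  fixes A :: "('x, 'o, 'm, 'z) enriched_data_scheme"
    and X and H and m and \<eta>
  defines "X \<equiv> Pts A" and "H \<equiv> HomO A" and "m \<equiv> Mult A" and "\<eta> \<equiv> Eta A"
  assumes hom_obj: "\<lbrakk>x \<in> X; y \<in> X\<rbrakk> \<Longrightarrow> H x y \<in> Obj V"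
    and mult_hom: "\<lbrakk>x \<in> X; y \<in> X; z \<in> X\<rbrakk> \<Longrightarrow> m x y z \<in> homs V (H x y \<otimes> H y z) (H x z)"
    and eta_hom: "x \<in> X \<Longrightarrow> \<eta> x \<in> homs V \<k> (H x x)"
    and mult_assoc: "\<lbrakk>x \<in> X; y \<in> X; z \<in> X; t \<in> X\<rbrakk>
      \<Longrightarrow> m x y t \<cdot> (\<one> (H x y) \<odot> m y z t) \<cdot> \<a> (H x y) (H y z) (H z t)
        = m x z t \<cdot> (m x y z \<odot> \<one> (H z t))"
    and mult_lunit: "\<lbrakk>x \<in> X; y \<in> X\<rbrakk> \<Longrightarrow> m x x y \<cdot> (\<eta> x \<odot> \<one> (H x y)) = \<l> (H x y)"
    and mult_runit: "\<lbrakk>x \<in> X; y \<in> X\<rbrakk> \<Longrightarrow> m x y y \<cdot> (\<one> (H x y) \<odot> \<eta> y) = \<r> (H x y)"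
    and hom_ext: "\<not> (x \<in> X \<and> y \<in> X) \<Longrightarrow> H x y = undefined"
    and mult_ext: "\<not> (x \<in> X \<and> y \<in> X \<and> z \<in> X) \<Longrightarrow> m x y z = undefined"
    and eta_ext: "x \<notin> X \<Longrightarrow> \<eta> x = undefined"

locale coalg_enriched_category =
  braided_monoidal_category V + enriched_category V A X H m \<eta>
  for V :: "('o, 'm) braided_cat" (structure)
    and A :: "('x, 'o, 'm, 'z) coalg_enriched_data_scheme" and X H m \<eta> +
  fixes \<Delta> and \<epsilon>
  defines "\<Delta> \<equiv> Comult A" and "\<epsilon> \<equiv> Counit A"
  assumes hom_coalgebra: "\<lbrakk>x \<in> X; y \<in> X\<rbrakk> \<Longrightarrow> coalgebra V (H x y) (\<Delta> x y) (\<epsilon> x y)"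
    and mult_coalgebra_morphism: "\<lbrakk>x \<in> X; y \<in> X; z \<in> X\<rbrakk>
      \<Longrightarrow> coalgebra_morphism V
            (H x y \<otimes> H y z)
            (tensor_comult V (H x y) (\<Delta> x y) (H y z) (\<Delta> y z))
            (tensor_counit V (\<epsilon> x y) (\<epsilon> y z))
            (H x z) (\<Delta> x z) (\<epsilon> x z) (m x y z)"
    and eta_coalgebra_morphism: "x \<in> X
      \<Longrightarrow> coalgebra_morphism V \<k> (unit_comult V) (unit_counit V)
            (H x x) (\<Delta> x x) (\<epsilon> x x) (\<eta> x)"
    and comult_ext: "\<not> (x \<in> X \<and> y \<in> X) \<Longrightarrow> \<Delta> x y = undefined"
    and counit_ext: "\<not> (x \<in> X \<and> y \<in> X) \<Longrightarrow> \<epsilon> x y = undefined"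

locale hopf_category = coalg_enriched_category V A X H m \<eta> \<Delta> \<epsilon>
  for V :: "('o, 'm) braided_cat" (structure)
    and A :: "('x, 'o, 'm, 'z) hopf_data_scheme" and X H m \<eta> \<Delta> \<epsilon> +
  fixes S
  defines "S \<equiv> Antipode A"
  assumes antipode_hom: "\<lbrakk>x \<in> X; y \<in> X\<rbrakk> \<Longrightarrow> S x y \<in> homs V (H x y) (H y x)"
    and antipode_right: "\<lbrakk>x \<in> X; y \<in> X\<rbrakk>
      \<Longrightarrow> m x y x \<cdot> (\<one> (H x y) \<odot> S x y) \<cdot> \<Delta> x y = \<eta> x \<cdot> \<epsilon> x y"
    and antipode_left: "\<lbrakk>x \<in> X; y \<in> X\<rbrakk>
      \<Longrightarrow> m y x y \<cdot> (S x y \<odot> \<one> (H x y)) \<cdot> \<Delta> x y = \<eta> y \<cdot> \<epsilon> x y"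
    and antipode_ext: "\<not> (x \<in> X \<and> y \<in> X) \<Longrightarrow> S x y = undefined"


section \<open>The category of sets\<close>

text \<open>
  The objects are the sets of elements of a type that contains an arbitrary type of atoms, a
  point and all ordered pairs of its elements, so that the sets are closed under cartesian
  products.
\<close>

datatype 'a univ = Atom 'a | Star | Tup "'a univ" "'a univ"

record 'u setmap =
  src :: "'u set"
  trg :: "'u set"
  app :: "'u \<Rightarrow> 'u"

definition mk_map :: "'u set \<Rightarrow> 'u set \<Rightarrow> ('u \<Rightarrow> 'u) \<Rightarrow> 'u setmap"
  where "mk_map A B f = \<lparr>src = A, trg = B, app = restrict f A\<rparr>"

definition cart :: "'a univ set \<Rightarrow> 'a univ set \<Rightarrow> 'a univ set"
  where "cart A B = {Tup a b | a b. a \<in> A \<and> b \<in> B}"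

fun fstT :: "'a univ \<Rightarrow> 'a univ" where "fstT (Tup a b) = a"

fun sndT :: "'a univ \<Rightarrow> 'a univ" where "sndT (Tup a b) = b"

definition SETS :: "('a univ set, 'a univ setmap) braided_cat"
  where "SETS = \<lparr>
    Obj = UNIV,
    Arr = {f. app f \<in> src f \<rightarrow>\<^sub>E trg f},
    Dom = src,
    Cod = trg,
    Id = (\<lambda>A. mk_map A A (\<lambda>a. a)),
    Cmp = (\<lambda>g f. mk_map (src f) (trg g) (\<lambda>a. app g (app f a))),
    TenO = cart,
    TenA = (\<lambda>f g. mk_map (cart (src f) (src g)) (cart (trg f) (trg g))
                    (\<lambda>p. Tup (app f (fstT p)) (app g (sndT p)))),
    UnitO = {Star},
    Assoc = (\<lambda>A B C. mk_map (cart (cart A B) C) (cart A (cart B C))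
                    (\<lambda>p. Tup (fstT (fstT p)) (Tup (sndT (fstT p)) (sndT p)))),
    LUnit = (\<lambda>A. mk_map (cart {Star} A) A sndT),
    RUnit = (\<lambda>A. mk_map (cart A {Star}) A fstT),
    Braid = (\<lambda>A B. mk_map (cart A B) (cart B A) (\<lambda>p. Tup (sndT p) (fstT p)))\<rparr>"


section \<open>Ordinary categories and groupoids\<close>

record ('x, 'u) cat_data =
  COb :: "'x set"
  CHom :: "'x \<Rightarrow> 'x \<Rightarrow> 'u set"
  CComp :: "'x \<Rightarrow> 'x \<Rightarrow> 'x \<Rightarrow> 'u \<Rightarrow> 'u \<Rightarrow> 'u"
  CId :: "'x \<Rightarrow> 'u"

text \<open>
  \<open>CComp C x y z b a\<close> is the composite of \<open>a : x \<rightarrow> y\<close> followed by \<open>b : y \<rightarrow> z\<close>.  As above,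
  the assumptions named \<open>_ext\<close> fix irrelevant values.
\<close>

locale ordinary_category =
  fixes C :: "('x, 'u) cat_data" and X and Hom and comp and ident
  defines "X \<equiv> COb C" and "Hom \<equiv> CHom C" and "comp \<equiv> CComp C" and "ident \<equiv> CId C"
  assumes comp_in: "\<lbrakk>x \<in> X; y \<in> X; z \<in> X; a \<in> Hom x y; b \<in> Hom y z\<rbrakk>
      \<Longrightarrow> comp x y z b a \<in> Hom x z"
    and ident_in: "x \<in> X \<Longrightarrow> ident x \<in> Hom x x"
    and comp_assoc: "\<lbrakk>x \<in> X; y \<in> X; z \<in> X; t \<in> X; a \<in> Hom x y; b \<in> Hom y z; c \<in> Hom z t\<rbrakk>
      \<Longrightarrow> comp x z t c (comp x y z b a) = comp x y t (comp y z t c b) a"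
    and comp_ident: "\<lbrakk>x \<in> X; y \<in> X; a \<in> Hom x y\<rbrakk> \<Longrightarrow> comp x x y a (ident x) = a"
    and ident_comp: "\<lbrakk>x \<in> X; y \<in> X; a \<in> Hom x y\<rbrakk> \<Longrightarrow> comp x y y (ident y) a = a"
    and Hom_ext: "\<not> (x \<in> X \<and> y \<in> X) \<Longrightarrow> Hom x y = {}"
    and comp_ext: "\<not> (a \<in> Hom x y \<and> b \<in> Hom y z) \<Longrightarrow> comp x y z b a = undefined"
    and ident_ext: "x \<notin> X \<Longrightarrow> ident x = undefined"

locale groupoid = ordinary_category +
  assumes invertible: "\<lbrakk>x \<in> X; y \<in> X; a \<in> Hom x y\<rbrakk>
      \<Longrightarrow> \<exists>b \<in> Hom y x. comp x y x b a = ident x \<and> comp y x y a b = ident y"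

text \<open>
  The ordinary category of a category enriched in sets: \<open>Hom(x, y)\<close> is the hom object of
  \<open>(y, x)\<close>, and \<open>b \<circ> a\<close> is \<open>m z y x (b, a)\<close>.
\<close>

definition ordinary_of ::
    "('x, 'a univ set, 'a univ setmap, 'z) enriched_data_scheme \<Rightarrow> ('x, 'a univ) cat_data"
  where "ordinary_of A = (let Hom = (\<lambda>x y. if x \<in> Pts A \<and> y \<in> Pts A then HomO A y x else {}) in
    \<lparr>COb = Pts A,
     CHom = Hom,
     CComp = (\<lambda>x y z b a. if a \<in> Hom x y \<and> b \<in> Hom y z
                          then app (Mult A z y x) (Tup b a) else undefined),
     CId = (\<lambda>x. if x \<in> Pts A then app (Eta A x) Star else undefined)\<rparr>)"

end

theory Submission
  imports Defs
begin

text \<open>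
  The counit laws force the comultiplication of a coalgebra in sets to be the diagonal, and every
  map commutes with diagonals and with maps to the point.  Hence a category enriched in coalgebras
  of sets is just a category enriched in sets, that is, an ordinary category read backwards.
  Evaluated at an element \<open>a\<close>, the antipode axioms say that \<open>S a\<close> is a two-sided inverse of \<open>a\<close>;
  since inverses are unique, an antipode exists exactly for groupoids and is then unique.
\<close>

section \<open>The braided monoidal category of sets\<close>

text \<open>With these rules every structure map and every composite becomes an
  \<open>mk_map\<close> term, so a diagram of arrows turns into an equation between explicit
  functions.\<close>

lemma SETS_simps [simp]:
  "Obj SETS = UNIV"
  "Arr SETS = {f. app f \<in> src f \<rightarrow>\<^sub>E trg f}"
  "Dom SETS = src"
  "Cod SETS = trg"
  "Id SETS A = mk_map A A (\<lambda>a. a)"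
  "Cmp SETS g f = mk_map (src f) (trg g) (\<lambda>a. app g (app f a))"
  "TenO SETS = cart"
  "TenA SETS f g = mk_map (cart (src f) (src g)) (cart (trg f) (trg g))
    (\<lambda>p. Tup (app f (fstT p)) (app g (sndT p)))"
  "UnitO SETS = {Star}"
  "Assoc SETS A B C = mk_map (cart (cart A B) C) (cart A (cart B C))
    (\<lambda>p. Tup (fstT (fstT p)) (Tup (sndT (fstT p)) (sndT p)))"
  "LUnit SETS A = mk_map (cart {Star} A) A sndT"
  "RUnit SETS A = mk_map (cart A {Star}) A fstT"
  "Braid SETS A B = mk_map (cart A B) (cart B A) (\<lambda>p. Tup (sndT p) (fstT p))"
  by (simp_all add: SETS_def)

lemma mk_map_simps [simp]:
  "src (mk_map A B f) = A"
  "trg (mk_map A B f) = B"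
  "app (mk_map A B f) = restrict f A"
  by (simp_all add: mk_map_def)

text \<open>\<open>restrict\<close> gives both functions the same value off the source, so only
  their values on it can differ. As a simp rule this reduces coherence laws to elementwise
  checks.\<close>

lemma mk_map_eq_iff [simp]:
  "mk_map A B f = mk_map A' B' g \<longleftrightarrow> A = A' \<and> B = B' \<and> (\<forall>a\<in>A. f a = g a)"
  by (auto simp: mk_map_def restrict_def fun_eq_iff)

lemma Tup_in_cart [simp]: "Tup a b \<in> cart A B \<longleftrightarrow> a \<in> A \<and> b \<in> B"
  by (auto simp: cart_def)

text \<open>Quantifying over the two components exposes the constructor \<open>Tup\<close>, on which
  alone \<open>fstT\<close> and \<open>sndT\<close> compute.\<close>

lemma ball_cart [simp]: "(\<forall>p\<in>cart A B. P p) \<longleftrightarrow> (\<forall>a\<in>A. \<forall>b\<in>B. P (Tup a b))"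
  by (auto simp: cart_def)

lemma homs_SETS: "homs SETS A B = {f. src f = A \<and> trg f = B \<and> app f \<in> A \<rightarrow>\<^sub>E B}"
  by (auto simp: homs_def)

lemma mk_map_homs [simp]: "mk_map A B f \<in> homs SETS A' B' \<longleftrightarrow> A = A' \<and> B = B' \<and> (\<forall>a\<in>A. f a \<in> B)"
  by (auto simp: homs_SETS PiE_def Pi_def)

lemma homs_SETS_D:
  assumes "f \<in> homs SETS A B"
  shows "src f = A" "trg f = B" "a \<in> A \<Longrightarrow> app f a \<in> B"
  using assms by (auto simp: homs_SETS)

lemma homs_SETS_eta: "f \<in> homs SETS A B \<Longrightarrow> mk_map A B (app f) = f"
  by (cases f) (simp add: homs_SETS mk_map_def)

lemma homs_SETS_eqI:
  assumes "f \<in> homs SETS A B" "g \<in> homs SETS A B" "\<And>a. a \<in> A \<Longrightarrow> app f a = app g a"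
  shows "f = g"
  using assms by (metis homs_SETS_eta mk_map_eq_iff)

text \<open>Replacing an arbitrary arrow by an \<open>mk_map\<close> term makes the simp rules above
  applicable to it; the functoriality and naturality laws of sets are settled in this way.\<close>

lemma homs_SETS_obtain:
  assumes "f \<in> homs SETS A B"
  obtains f' where "f = mk_map A B f'" "\<forall>a\<in>A. f' a \<in> B"
  using assms homs_SETS_D homs_SETS_eta by metis

lemma category_SETS: "category_axms SETS"
proof
  fix f :: "'a univ setmap" and A B assume "f \<in> homs SETS A B"
  then show "f \<cdot>\<^bsub>SETS\<^esub> \<one>\<^bsub>SETS\<^esub> A = f" "\<one>\<^bsub>SETS\<^esub> B \<cdot>\<^bsub>SETS\<^esub> f = f"
    by (auto elim!: homs_SETS_obtain)
qed (auto elim!: homs_SETS_obtain)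

text \<open>Two inverses of an arrow agree by
  \<open>h = h \<cdot> (f \<cdot> g) = (h \<cdot> f) \<cdot> g = g\<close>, so the description in
  \<open>Inv\<close> has a unique solution and any exhibited inverse computes it.\<close>

lemma (in category_axms) Inv_eq:
  assumes "inverse_arrows V f g"
  shows "Inv V f = g"
  unfolding Inv_def
proof (rule the_equality)
  show "inverse_arrows V f g" by (rule assms)
next
  fix h assume h: "inverse_arrows V f h"
  have f: "f \<in> homs V (Dom V f) (Cod V f)"
    using h by (simp add: inverse_arrows_def homs_def)
  have "h = h \<cdot> (f \<cdot> g)"
    using assms h cmp_id[of h "Cod V f" "Dom V f"] by (simp add: inverse_arrows_def)
  also have "\<dots> = (h \<cdot> f) \<cdot> g"
    using assms h cmp_assoc[OF _ f, of g "Cod V f" h "Dom V f"] by (simp add: inverse_arrows_def)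
  also have "\<dots> = g"
    using assms h id_cmp[of g "Cod V f" "Dom V f"] by (simp add: inverse_arrows_def)
  finally show "h = g" .
qed

section \<open>Structural isomorphisms of sets and their inverses\<close>

lemma inverse_arrows_SETS:
  assumes "\<forall>a\<in>A. f a \<in> B \<and> g (f a) = a" "\<forall>b\<in>B. g b \<in> A \<and> f (g b) = b"
  shows "inverse_arrows SETS (mk_map A B f) (mk_map B A g)"
  using assms by (auto simp: inverse_arrows_def)

lemmas Inv_SETS = category_axms.Inv_eq[OF category_SETS inverse_arrows_SETS]

lemma mk_map_isos:
  assumes "\<forall>a\<in>A. f a \<in> B \<and> g (f a) = a" "\<forall>b\<in>B. g b \<in> A \<and> f (g b) = b"
  shows "mk_map A B f \<in> isos SETS A B"
  using assms inverse_arrows_SETS[OF assms] by (auto simp: isos_def)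

text \<open>The left side is the associator in the form left by \<open>SETS_simps\<close>, so the
  rule fires on the inverse associators in the second hexagon and in
  \<open>interchange\<close>.\<close>

lemma Inv_Assoc_SETS [simp]:
  "Inv SETS (mk_map (cart (cart A B) C) (cart A (cart B C))
      (\<lambda>p. Tup (fstT (fstT p)) (Tup (sndT (fstT p)) (sndT p))))
    = mk_map (cart A (cart B C)) (cart (cart A B) C)
      (\<lambda>p. Tup (Tup (fstT p) (fstT (sndT p))) (sndT (sndT p)))"
  by (rule Inv_SETS) auto

lemma Inv_LUnit_SETS [simp]:
  "Inv SETS (mk_map (cart {Star} A) A sndT) = mk_map A (cart {Star} A) (Tup Star)"
  by (rule Inv_SETS) auto

lemma monoidal_SETS: "monoidal_category SETS"
proof -
  interpret category_axms SETS by (rule category_SETS)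
  show ?thesis
  proof
    fix A B C :: "'a univ set"
    show "\<a>\<^bsub>SETS\<^esub> A B C \<in> isos SETS ((A \<otimes>\<^bsub>SETS\<^esub> B) \<otimes>\<^bsub>SETS\<^esub> C) (A \<otimes>\<^bsub>SETS\<^esub> (B \<otimes>\<^bsub>SETS\<^esub> C))"
      unfolding SETS_simps
      by (rule mk_map_isos[where g = "\<lambda>p. Tup (Tup (fstT p) (fstT (sndT p))) (sndT (sndT p))"]) auto
    show "\<l>\<^bsub>SETS\<^esub> A \<in> isos SETS (\<k>\<^bsub>SETS\<^esub> \<otimes>\<^bsub>SETS\<^esub> A) A"
      unfolding SETS_simps by (rule mk_map_isos[where g = "Tup Star"]) auto
    show "\<r>\<^bsub>SETS\<^esub> A \<in> isos SETS (A \<otimes>\<^bsub>SETS\<^esub> \<k>\<^bsub>SETS\<^esub>) A"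
      unfolding SETS_simps by (rule mk_map_isos[where g = "\<lambda>a. Tup a Star"]) auto
  qed (auto elim!: homs_SETS_obtain)
qed

lemma braided_SETS: "braided_monoidal_category SETS"
proof -
  interpret monoidal_category SETS by (rule monoidal_SETS)
  show ?thesis
  proof
    fix A B :: "'a univ set"
    show "\<c>\<^bsub>SETS\<^esub> A B \<in> isos SETS (A \<otimes>\<^bsub>SETS\<^esub> B) (B \<otimes>\<^bsub>SETS\<^esub> A)"
      unfolding SETS_simps by (rule mk_map_isos[where g = "\<lambda>p. Tup (sndT p) (fstT p)"]) auto
  qed (auto elim!: homs_SETS_obtain)
qed


section \<open>Coalgebras in the category of sets\<close>

definition diag :: "'a univ set \<Rightarrow> 'a univ setmap"
  where "diag A = mk_map A (cart A A) (\<lambda>a. Tup a a)"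

definition terminal_map :: "'a univ set \<Rightarrow> 'a univ setmap"
  where "terminal_map A = mk_map A {Star} (\<lambda>_. Star)"

text \<open>The counit is forced because \<open>{Star}\<close> is terminal, and the two counit laws
  then force each component of the comultiplication to be the identity. Conversely the diagonal
  satisfies all coalgebra laws.\<close>

lemma coalgebra_SETS_iff:
  "coalgebra SETS A \<Delta> \<epsilon> \<longleftrightarrow> \<Delta> = diag A \<and> \<epsilon> = terminal_map A"
proof
  assume "coalgebra SETS A \<Delta> \<epsilon>"
  then interpret coalgebra SETS A \<Delta> \<epsilon> .
  obtain d where d: "\<Delta> = mk_map A (cart A A) d" "\<forall>a\<in>A. d a \<in> cart A A"
    using comult_hom by (auto elim: homs_SETS_obtain)
  obtain e where e: "\<epsilon> = mk_map A {Star} e" "\<forall>a\<in>A. e a = Star"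
    using counit_hom by (auto elim: homs_SETS_obtain)
  have "d a = Tup a a" if a: "a \<in> A" for a
  proof -
    \<comment> \<open>Evaluated at \<open>a\<close>, the left counit law erases \<open>b\<close> and
      the right one erases \<open>c\<close>, so the component that remains equals \<open>a\<close>
      in each case.\<close>
    obtain b c where bc: "d a = Tup b c" "b \<in> A" "c \<in> A"
      using bspec[OF d(2) a] by (auto simp: cart_def)
    have "app (\<l>\<^bsub>SETS\<^esub> A \<cdot>\<^bsub>SETS\<^esub> (\<epsilon> \<odot>\<^bsub>SETS\<^esub> \<one>\<^bsub>SETS\<^esub> A) \<cdot>\<^bsub>SETS\<^esub> \<Delta>) a = app (\<one>\<^bsub>SETS\<^esub> A) a"
      by (simp only: lcounit)
    then have "c = a"
      using a bc by (simp add: d(1) e)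
    moreover have "app (\<r>\<^bsub>SETS\<^esub> A \<cdot>\<^bsub>SETS\<^esub> (\<one>\<^bsub>SETS\<^esub> A \<odot>\<^bsub>SETS\<^esub> \<epsilon>) \<cdot>\<^bsub>SETS\<^esub> \<Delta>) a = app (\<one>\<^bsub>SETS\<^esub> A) a"
      by (simp only: rcounit)
    then have "b = a"
      using a bc by (simp add: d(1) e)
    ultimately show ?thesis using bc by simp
  qed
  then show "\<Delta> = diag A \<and> \<epsilon> = terminal_map A"
    using d e by (simp add: diag_def terminal_map_def)
next
  interpret monoidal_category SETS by (rule monoidal_SETS)
  assume "\<Delta> = diag A \<and> \<epsilon> = terminal_map A"
  then show "coalgebra SETS A \<Delta> \<epsilon>"
    by unfold_locales (auto simp: diag_def terminal_map_def)
qed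

text \<open>Swapping the two middle entries of \<open>((a, a), (b, b))\<close> yields
  \<open>((a, b), (a, b))\<close>.\<close>

lemma tensor_comult_SETS: "tensor_comult SETS A (diag A) B (diag B) = diag (cart A B)"
  by (simp add: tensor_comult_def interchange_def diag_def)

lemma tensor_counit_SETS:
  "tensor_counit SETS (terminal_map A) (terminal_map B) = terminal_map (cart A B)"
  by (simp add: tensor_counit_def terminal_map_def)

lemma unit_comult_SETS: "unit_comult SETS = diag {Star}"
  by (simp add: unit_comult_def diag_def)

lemma unit_counit_SETS: "unit_counit SETS = terminal_map {Star}"
  by (simp add: unit_counit_def terminal_map_def)

text \<open>Diagonals are natural and \<open>{Star}\<close> is terminal, so the conditions that
  multiplications and units be coalgebra morphisms hold automatically in sets.\<close>

lemma coalgebra_morphism_SETS: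
  assumes "f \<in> homs SETS A B"
  shows "coalgebra_morphism SETS A (diag A) (terminal_map A) B (diag B) (terminal_map B) f"
  using assms by (auto simp: coalgebra_morphism_def diag_def terminal_map_def elim!: homs_SETS_obtain)


section \<open>Enriched categories over sets as ordinary categories\<close>

text \<open>The typing hypotheses make the sources and targets of both composites agree, which
  leaves only their values on triples to compare.\<close>

lemma assoc_SETS_iff:
  assumes "f \<in> homs SETS (cart A B) D" "g \<in> homs SETS (cart B C) E"
    and "h \<in> homs SETS (cart A E) F" "k \<in> homs SETS (cart D C) F"
  shows "h \<cdot>\<^bsub>SETS\<^esub> (\<one>\<^bsub>SETS\<^esub> A \<odot>\<^bsub>SETS\<^esub> g) \<cdot>\<^bsub>SETS\<^esub> \<a>\<^bsub>SETS\<^esub> A B C = k \<cdot>\<^bsub>SETS\<^esub> (f \<odot>\<^bsub>SETS\<^esub> \<one>\<^bsub>SETS\<^esub> C) \<longleftrightarrow>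
    (\<forall>a\<in>A. \<forall>b\<in>B. \<forall>c\<in>C. app h (Tup a (app g (Tup b c))) = app k (Tup (app f (Tup a b)) c))"
  using assms by (auto simp: homs_SETS_D)

lemma lunit_SETS_iff:
  assumes "f \<in> homs SETS (cart B A) A" "u \<in> homs SETS {Star} B"
  shows "f \<cdot>\<^bsub>SETS\<^esub> (u \<odot>\<^bsub>SETS\<^esub> \<one>\<^bsub>SETS\<^esub> A) = \<l>\<^bsub>SETS\<^esub> A \<longleftrightarrow> (\<forall>a\<in>A. app f (Tup (app u Star) a) = a)"
  using assms by (auto simp: homs_SETS_D)

lemma runit_SETS_iff:
  assumes "f \<in> homs SETS (cart A B) A" "u \<in> homs SETS {Star} B"
  shows "f \<cdot>\<^bsub>SETS\<^esub> (\<one>\<^bsub>SETS\<^esub> A \<odot>\<^bsub>SETS\<^esub> u) = \<r>\<^bsub>SETS\<^esub> A \<longleftrightarrow> (\<forall>a\<in>A. app f (Tup a (app u Star)) = a)"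
  using assms by (auto simp: homs_SETS_D)

text \<open>Introduction rule in terms of elements, the form in which the laws of an ordinary
  category are available.\<close>

lemma enriched_category_SETS_I:
  assumes mult: "\<And>x y z. \<lbrakk>x \<in> Pts A; y \<in> Pts A; z \<in> Pts A\<rbrakk> \<Longrightarrow>
      Mult A x y z \<in> homs SETS (cart (HomO A x y) (HomO A y z)) (HomO A x z)"
    and eta: "\<And>x. x \<in> Pts A \<Longrightarrow> Eta A x \<in> homs SETS {Star} (HomO A x x)"
    and assoc: "\<And>x y z t a b c. \<lbrakk>x \<in> Pts A; y \<in> Pts A; z \<in> Pts A; t \<in> Pts A;
        a \<in> HomO A x y; b \<in> HomO A y z; c \<in> HomO A z t\<rbrakk> \<Longrightarrow>
      app (Mult A x y t) (Tup a (app (Mult A y z t) (Tup b c))) =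
      app (Mult A x z t) (Tup (app (Mult A x y z) (Tup a b)) c)"
    and lunit: "\<And>x y a. \<lbrakk>x \<in> Pts A; y \<in> Pts A; a \<in> HomO A x y\<rbrakk> \<Longrightarrow>
      app (Mult A x x y) (Tup (app (Eta A x) Star) a) = a"
    and runit: "\<And>x y a. \<lbrakk>x \<in> Pts A; y \<in> Pts A; a \<in> HomO A x y\<rbrakk> \<Longrightarrow>
      app (Mult A x y y) (Tup a (app (Eta A y) Star)) = a"
    and hom_ext: "\<And>x y. \<not> (x \<in> Pts A \<and> y \<in> Pts A) \<Longrightarrow> HomO A x y = undefined"
    and mult_ext: "\<And>x y z. \<not> (x \<in> Pts A \<and> y \<in> Pts A \<and> z \<in> Pts A) \<Longrightarrow> Mult A x y z = undefined"
    and eta_ext: "\<And>x. x \<notin> Pts A \<Longrightarrow> Eta A x = undefined"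
  shows "enriched_category SETS A"
proof -
  interpret monoidal_category SETS by (rule monoidal_SETS)
  show ?thesis
  proof
    fix x y z t assume "x \<in> Pts A" "y \<in> Pts A" "z \<in> Pts A" "t \<in> Pts A"
    then show "Mult A x y t \<cdot>\<^bsub>SETS\<^esub> (\<one>\<^bsub>SETS\<^esub> (HomO A x y) \<odot>\<^bsub>SETS\<^esub> Mult A y z t) \<cdot>\<^bsub>SETS\<^esub>
        \<a>\<^bsub>SETS\<^esub> (HomO A x y) (HomO A y z) (HomO A z t) =
      Mult A x z t \<cdot>\<^bsub>SETS\<^esub> (Mult A x y z \<odot>\<^bsub>SETS\<^esub> \<one>\<^bsub>SETS\<^esub> (HomO A z t))"
      by (subst assoc_SETS_iff[OF mult mult mult mult]) (assumption | intro ballI assoc)+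
  next
    fix x y assume "x \<in> Pts A" "y \<in> Pts A"
    then show "Mult A x x y \<cdot>\<^bsub>SETS\<^esub> (Eta A x \<odot>\<^bsub>SETS\<^esub> \<one>\<^bsub>SETS\<^esub> (HomO A x y)) = \<l>\<^bsub>SETS\<^esub> (HomO A x y)"
      by (subst lunit_SETS_iff[OF mult eta]) (assumption | intro ballI lunit)+
  next
    fix x y assume "x \<in> Pts A" "y \<in> Pts A"
    then show "Mult A x y y \<cdot>\<^bsub>SETS\<^esub> (\<one>\<^bsub>SETS\<^esub> (HomO A x y) \<odot>\<^bsub>SETS\<^esub> Eta A y) = \<r>\<^bsub>SETS\<^esub> (HomO A x y)"
      by (subst runit_SETS_iff[OF mult eta]) (assumption | intro ballI runit)+
  qed (simp_all only: SETS_simps mult eta hom_ext mult_ext eta_ext UNIV_I not_False_eq_True simp_thms)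
qed

lemma enriched_category_SETS_D:
  assumes "enriched_category SETS A"
  shows "\<lbrakk>x \<in> Pts A; y \<in> Pts A; z \<in> Pts A\<rbrakk> \<Longrightarrow>
      Mult A x y z \<in> homs SETS (cart (HomO A x y) (HomO A y z)) (HomO A x z)"
    and "\<lbrakk>x \<in> Pts A; y \<in> Pts A; z \<in> Pts A; a \<in> HomO A x y; b \<in> HomO A y z\<rbrakk> \<Longrightarrow>
      app (Mult A x y z) (Tup a b) \<in> HomO A x z"
    and "x \<in> Pts A \<Longrightarrow> Eta A x \<in> homs SETS {Star} (HomO A x x)"
    and "x \<in> Pts A \<Longrightarrow> app (Eta A x) Star \<in> HomO A x x"
    and "\<lbrakk>x \<in> Pts A; y \<in> Pts A; z \<in> Pts A; t \<in> Pts A;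
        a \<in> HomO A x y; b \<in> HomO A y z; c \<in> HomO A z t\<rbrakk> \<Longrightarrow>
      app (Mult A x y t) (Tup a (app (Mult A y z t) (Tup b c))) =
      app (Mult A x z t) (Tup (app (Mult A x y z) (Tup a b)) c)"
    and "\<lbrakk>x \<in> Pts A; y \<in> Pts A; a \<in> HomO A x y\<rbrakk> \<Longrightarrow>
      app (Mult A x x y) (Tup (app (Eta A x) Star) a) = a"
    and "\<lbrakk>x \<in> Pts A; y \<in> Pts A; a \<in> HomO A x y\<rbrakk> \<Longrightarrow>
      app (Mult A x y y) (Tup a (app (Eta A y) Star)) = a"
proof -
  note mult = enriched_category.mult_hom[OF assms, unfolded SETS_simps]
    and eta = enriched_category.eta_hom[OF assms, unfolded SETS_simps]
  show "Mult A x y z \<in> homs SETS (cart (HomO A x y) (HomO A y z)) (HomO A x z)"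
    if "x \<in> Pts A" "y \<in> Pts A" "z \<in> Pts A"
    by (rule mult) fact+
  show "Eta A x \<in> homs SETS {Star} (HomO A x x)" if "x \<in> Pts A"
    by (rule eta) fact
  show "app (Mult A x y z) (Tup a b) \<in> HomO A x z"
    if "x \<in> Pts A" "y \<in> Pts A" "z \<in> Pts A" "a \<in> HomO A x y" "b \<in> HomO A y z"
    using homs_SETS_D(3)[OF mult] that by simp
  show "app (Eta A x) Star \<in> HomO A x x" if "x \<in> Pts A"
    using homs_SETS_D(3)[OF eta] that by simp
  show "app (Mult A x y t) (Tup a (app (Mult A y z t) (Tup b c))) =
      app (Mult A x z t) (Tup (app (Mult A x y z) (Tup a b)) c)"
    if "x \<in> Pts A" "y \<in> Pts A" "z \<in> Pts A" "t \<in> Pts A"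
      "a \<in> HomO A x y" "b \<in> HomO A y z" "c \<in> HomO A z t"
    using enriched_category.mult_assoc[OF assms that(1-4)] that
    by (subst (asm) assoc_SETS_iff[OF mult mult mult mult]) (assumption | blast)+
  show "app (Mult A x x y) (Tup (app (Eta A x) Star) a) = a"
    if "x \<in> Pts A" "y \<in> Pts A" "a \<in> HomO A x y"
    using enriched_category.mult_lunit[OF assms that(1,2)] that
    by (subst (asm) lunit_SETS_iff[OF mult eta]) (assumption | blast)+
  show "app (Mult A x y y) (Tup a (app (Eta A y) Star)) = a"
    if "x \<in> Pts A" "y \<in> Pts A" "a \<in> HomO A x y"
    using enriched_category.mult_runit[OF assms that(1,2)] that
    by (subst (asm) runit_SETS_iff[OF mult eta]) (assumption | blast)+
qed

text \<open>Uniqueness of the coalgebra structure on a set fixes the two extra fields on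
  \<open>Pts A\<close>, the extensionality assumptions fix them elsewhere, and the morphism
  conditions are automatic.\<close>

lemma coalg_enriched_category_SETS_iff:
  "coalg_enriched_category SETS A \<longleftrightarrow> enriched_category SETS A \<and>
    Comult A = (\<lambda>x y. if x \<in> Pts A \<and> y \<in> Pts A then diag (HomO A x y) else undefined) \<and>
    Counit A = (\<lambda>x y. if x \<in> Pts A \<and> y \<in> Pts A then terminal_map (HomO A x y) else undefined)"
  (is "_ \<longleftrightarrow> _ \<and> ?comult \<and> ?counit")
proof
  assume "coalg_enriched_category SETS A"
  then interpret coalg_enriched_category SETS A "Pts A" "HomO A" "Mult A" "Eta A" "Comult A" "Counit A"
    by simp_all
  have ?comult ?counit
    using hom_coalgebra comult_ext counit_ext by (auto simp: coalgebra_SETS_iff fun_eq_iff)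
  then show "enriched_category SETS A \<and> ?comult \<and> ?counit"
    using enriched_category_axioms by blast
next
  assume *: "enriched_category SETS A \<and> ?comult \<and> ?counit"
  have "coalg_enriched_category_axioms SETS A"
    using * unfolding coalg_enriched_category_axioms_def
    by (simp add: coalgebra_SETS_iff tensor_comult_SETS tensor_counit_SETS unit_comult_SETS
        unit_counit_SETS coalgebra_morphism_SETS enriched_category_SETS_D)
  then show "coalg_enriched_category SETS A"
    using * braided_SETS by (simp add: coalg_enriched_category_def)
qed

lemma ordinary_of_simps [simp]:
  "COb (ordinary_of A) = Pts A"
  "CHom (ordinary_of A) x y = (if x \<in> Pts A \<and> y \<in> Pts A then HomO A y x else {})"
  "CComp (ordinary_of A) x y z b a =
    (if x \<in> Pts A \<and> y \<in> Pts A \<and> z \<in> Pts A \<and> a \<in> HomO A y x \<and> b \<in> HomO A z y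
     then app (Mult A z y x) (Tup b a) else undefined)"
  "CId (ordinary_of A) x = (if x \<in> Pts A then app (Eta A x) Star else undefined)"
  by (auto simp: ordinary_of_def Let_def)

text \<open>Because the direction of arrows is reversed, the right unit law becomes
  \<open>comp_ident\<close> and the left one \<open>ident_comp\<close>.\<close>

lemma ordinary_category_ordinary_of:
  assumes "enriched_category SETS A"
  shows "ordinary_category (ordinary_of A)"
  by unfold_locales (auto simp: enriched_category_SETS_D[OF assms] split: if_splits)

text \<open>Intended inverse of \<open>ordinary_of\<close>. In a pair the first component is the
  arrow applied last, as in \<open>m z y x (b, a)\<close>. The value \<open>undefined\<close> off
  the objects matches the extensionality assumptions, so that the inverse laws are equalities of
  records; on the ordinary side hom sets off the objects are empty instead.\<close>

definition coalg_enriched_of ::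
    "('x, 'a univ) cat_data \<Rightarrow> ('x, 'a univ set, 'a univ setmap) coalg_enriched_data"
  where "coalg_enriched_of C =
    \<lparr>Pts = COb C,
     HomO = (\<lambda>x y. if x \<in> COb C \<and> y \<in> COb C then CHom C y x else undefined),
     Mult = (\<lambda>x y z. if x \<in> COb C \<and> y \<in> COb C \<and> z \<in> COb C
       then mk_map (cart (CHom C y x) (CHom C z y)) (CHom C z x)
         (\<lambda>p. CComp C z y x (fstT p) (sndT p)) else undefined),
     Eta = (\<lambda>x. if x \<in> COb C then mk_map {Star} (CHom C x x) (\<lambda>_. CId C x) else undefined),
     Comult = (\<lambda>x y. if x \<in> COb C \<and> y \<in> COb C then diag (CHom C y x) else undefined),
     Counit = (\<lambda>x y. if x \<in> COb C \<and> y \<in> COb C then terminal_map (CHom C y x) else undefined)\<rparr>"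

lemma coalg_enriched_category_coalg_enriched_of:
  assumes "ordinary_category C"
  shows "coalg_enriched_category SETS (coalg_enriched_of C)"
proof -
  interpret ordinary_category C "COb C" "CHom C" "CComp C" "CId C"
    by (rule assms) simp_all
  show ?thesis
    unfolding coalg_enriched_category_SETS_iff
    by (intro conjI enriched_category_SETS_I)
      (auto simp: coalg_enriched_of_def comp_in ident_in comp_ident ident_comp comp_assoc intro!: ext)
qed

lemma ordinary_of_coalg_enriched_of:
  assumes "ordinary_category C"
  shows "ordinary_of (coalg_enriched_of C) = C"
proof -
  interpret ordinary_category C "COb C" "CHom C" "CComp C" "CId C"
    by (rule assms) simp_all
  \<comment> \<open>Hom sets off the objects are empty, so an arrow determines that its ends are
    objects; this discharges the object tests in \<open>ordinary_of\<close>.\<close>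
  have mem: "x \<in> COb C" "y \<in> COb C" if "a \<in> CHom C x y" for a x y
    using Hom_ext[of x y] that by auto
  show ?thesis
    by (rule cat_data.equality)
      (auto simp: coalg_enriched_of_def fun_eq_iff Hom_ext comp_ext ident_ext dest: mem)
qed

lemma coalg_enriched_of_ordinary_of:
  assumes "coalg_enriched_category SETS A"
  shows "coalg_enriched_of (ordinary_of A) = A"
proof (rule coalg_enriched_data.equality)
  have A: "enriched_category SETS A"
    using assms by (simp add: coalg_enriched_category_SETS_iff)
  \<comment> \<open>Default values off \<open>Pts A\<close>. The local name hides function
    extensionality, which is therefore called \<open>HOL.ext\<close> below.\<close>
  note ext = enriched_category.hom_ext[OF A] enriched_category.mult_ext[OF A]
    enriched_category.eta_ext[OF A]
  show "HomO (coalg_enriched_of (ordinary_of A)) = HomO A"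
    by (intro HOL.ext) (auto simp: coalg_enriched_of_def ext)
  show "Mult (coalg_enriched_of (ordinary_of A)) = Mult A"
  proof (intro HOL.ext)
    fix x y z
    show "Mult (coalg_enriched_of (ordinary_of A)) x y z = Mult A x y z"
    proof (cases "x \<in> Pts A \<and> y \<in> Pts A \<and> z \<in> Pts A")
      case True
      \<comment> \<open>The multiplication of \<open>A\<close> is expanded into an
        \<open>mk_map\<close> term, so that \<open>mk_map_eq_iff\<close> can compare it with the
        reconstructed one.\<close>
      then show ?thesis
        by (subst homs_SETS_eta[OF enriched_category_SETS_D(1)[OF A], symmetric])
          (auto simp: coalg_enriched_of_def)
    qed (auto simp: coalg_enriched_of_def ext)
  qed
  show "Eta (coalg_enriched_of (ordinary_of A)) = Eta A"
  proof (intro HOL.ext)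
    fix x
    show "Eta (coalg_enriched_of (ordinary_of A)) x = Eta A x"
    proof (cases "x \<in> Pts A")
      case True
      then show ?thesis
        by (subst homs_SETS_eta[OF enriched_category_SETS_D(3)[OF A], symmetric])
          (auto simp: coalg_enriched_of_def)
    qed (simp add: coalg_enriched_of_def ext)
  qed
qed (use assms in \<open>auto simp: coalg_enriched_of_def coalg_enriched_category_SETS_iff fun_eq_iff\<close>)

lemma bij_betw_ordinary_of:
  "bij_betw ordinary_of
    {A :: ('x, 'a univ set, 'a univ setmap) coalg_enriched_data. coalg_enriched_category SETS A}
    {C. ordinary_category C}"
  by (rule bij_betw_byWitness[where f' = coalg_enriched_of])
    (auto simp: coalg_enriched_of_ordinary_of ordinary_of_coalg_enriched_of
      coalg_enriched_category_coalg_enriched_of ordinary_category_ordinary_of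
      coalg_enriched_category_SETS_iff[THEN iffD1])


section \<open>Antipodes and inverses\<close>

text \<open>\<open>diag\<close> duplicates \<open>a\<close> and \<open>terminal_map\<close> sends it
  to \<open>Star\<close>, so the antipode axiom evaluated at \<open>a\<close> is an inverse
  equation.\<close>

lemma antipode_right_SETS_iff:
  assumes "f \<in> homs SETS (cart A B) C" "s \<in> homs SETS A B" "u \<in> homs SETS {Star} C"
  shows "f \<cdot>\<^bsub>SETS\<^esub> (\<one>\<^bsub>SETS\<^esub> A \<odot>\<^bsub>SETS\<^esub> s) \<cdot>\<^bsub>SETS\<^esub> diag A = u \<cdot>\<^bsub>SETS\<^esub> terminal_map A \<longleftrightarrow>
    (\<forall>a\<in>A. app f (Tup a (app s a)) = app u Star)"
  using assms by (auto simp: homs_SETS_D diag_def terminal_map_def)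

lemma antipode_left_SETS_iff:
  assumes "f \<in> homs SETS (cart B A) C" "s \<in> homs SETS A B" "u \<in> homs SETS {Star} C"
  shows "f \<cdot>\<^bsub>SETS\<^esub> (s \<odot>\<^bsub>SETS\<^esub> \<one>\<^bsub>SETS\<^esub> A) \<cdot>\<^bsub>SETS\<^esub> diag A = u \<cdot>\<^bsub>SETS\<^esub> terminal_map A \<longleftrightarrow>
    (\<forall>a\<in>A. app f (Tup (app s a) a) = app u Star)"
  using assms by (auto simp: homs_SETS_D diag_def terminal_map_def)

text \<open>Two-sided inverse in enriched indexing: for objects \<open>x\<close> and
  \<open>y\<close>, an element \<open>a\<close> of \<open>HomO A x y\<close> is an arrow from
  \<open>y\<close> to \<open>x\<close> of the ordinary category.\<close>

definition inverse_elements ::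
    "('x, 'a univ set, 'a univ setmap, 'z) enriched_data_scheme \<Rightarrow> 'x \<Rightarrow> 'x \<Rightarrow> 'a univ \<Rightarrow> 'a univ \<Rightarrow> bool"
  where "inverse_elements A x y a b \<longleftrightarrow> b \<in> HomO A y x \<and>
    app (Mult A x y x) (Tup a b) = app (Eta A x) Star \<and>
    app (Mult A y x y) (Tup b a) = app (Eta A y) Star"

text \<open>The usual computation \<open>b = b(ac) = (ba)c = c\<close>; it later yields uniqueness
  of the antipode.\<close>

lemma inverse_elements_unique:
  assumes "enriched_category SETS A" "x \<in> Pts A" "y \<in> Pts A" "a \<in> HomO A x y"
    and "inverse_elements A x y a b" "inverse_elements A x y a c"
  shows "b = c"
proof -
  have "b = app (Mult A y x x) (Tup b (app (Mult A x y x) (Tup a c)))"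
    using assms by (simp add: enriched_category_SETS_D inverse_elements_def)
  also have "\<dots> = app (Mult A y y x) (Tup (app (Mult A y x y) (Tup b a)) c)"
    using assms by (intro enriched_category_SETS_D) (simp_all add: inverse_elements_def)
  also have "\<dots> = c"
    using assms by (simp add: enriched_category_SETS_D inverse_elements_def)
  finally show ?thesis .
qed

lemma hopf_category_SETS_iff:
  "hopf_category SETS A \<longleftrightarrow> coalg_enriched_category SETS A \<and>
    (\<forall>x\<in>Pts A. \<forall>y\<in>Pts A. Antipode A x y \<in> homs SETS (HomO A x y) (HomO A y x)) \<and>
    (\<forall>x\<in>Pts A. \<forall>y\<in>Pts A. \<forall>a\<in>HomO A x y. inverse_elements A x y a (app (Antipode A x y) a)) \<and>
    (\<forall>x y. \<not> (x \<in> Pts A \<and> y \<in> Pts A) \<longrightarrow> Antipode A x y = undefined)"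
proof -
  \<comment> \<open>Only the typing of the antipode is assumed here, not its axioms, so that the
    equivalence serves both directions.\<close>
  have antipode: "(Mult A x y x \<cdot>\<^bsub>SETS\<^esub> (\<one>\<^bsub>SETS\<^esub> (HomO A x y) \<odot>\<^bsub>SETS\<^esub> Antipode A x y) \<cdot>\<^bsub>SETS\<^esub> Comult A x y =
        Eta A x \<cdot>\<^bsub>SETS\<^esub> Counit A x y \<and>
      Mult A y x y \<cdot>\<^bsub>SETS\<^esub> (Antipode A x y \<odot>\<^bsub>SETS\<^esub> \<one>\<^bsub>SETS\<^esub> (HomO A x y)) \<cdot>\<^bsub>SETS\<^esub> Comult A x y =
        Eta A y \<cdot>\<^bsub>SETS\<^esub> Counit A x y) \<longleftrightarrow>
      (\<forall>a\<in>HomO A x y. inverse_elements A x y a (app (Antipode A x y) a))"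
    if A: "coalg_enriched_category SETS A" and xy: "x \<in> Pts A" "y \<in> Pts A"
      and S: "Antipode A x y \<in> homs SETS (HomO A x y) (HomO A y x)" for x y
  proof -
    have "Mult A x y x \<in> homs SETS (cart (HomO A x y) (HomO A y x)) (HomO A x x)"
      "Mult A y x y \<in> homs SETS (cart (HomO A y x) (HomO A x y)) (HomO A y y)"
      "Eta A x \<in> homs SETS {Star} (HomO A x x)" "Eta A y \<in> homs SETS {Star} (HomO A y y)"
      "Comult A x y = diag (HomO A x y)" "Counit A x y = terminal_map (HomO A x y)"
      using A xy by (simp_all add: coalg_enriched_category_SETS_iff enriched_category_SETS_D)
    then show ?thesis
      using S homs_SETS_D(3)[OF S]
      by (simp only: antipode_right_SETS_iff antipode_left_SETS_iff inverse_elements_def) blast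
  qed
  show ?thesis
  proof (intro iffI conjI ballI allI impI; (elim conjE)?)
    assume "hopf_category SETS A"
    then interpret hopf_category SETS A "Pts A" "HomO A" "Mult A" "Eta A" "Comult A" "Counit A" "Antipode A"
      by simp_all
    show A: "coalg_enriched_category SETS A"
      by (rule coalg_enriched_category_axioms)
    fix x y
    show "Antipode A x y \<in> homs SETS (HomO A x y) (HomO A y x)" if "x \<in> Pts A" "y \<in> Pts A"
      by (rule antipode_hom) fact+
    show "inverse_elements A x y a (app (Antipode A x y) a)"
      if "x \<in> Pts A" "y \<in> Pts A" "a \<in> HomO A x y" for a
      using antipode[OF A that(1,2) antipode_hom] antipode_right antipode_left that by blast
    show "Antipode A x y = undefined" if "\<not> (x \<in> Pts A \<and> y \<in> Pts A)"
      by (rule antipode_ext) fact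
  next
    assume A: "coalg_enriched_category SETS A"
      and S: "\<forall>x\<in>Pts A. \<forall>y\<in>Pts A. Antipode A x y \<in> homs SETS (HomO A x y) (HomO A y x)"
      and inv: "\<forall>x\<in>Pts A. \<forall>y\<in>Pts A. \<forall>a\<in>HomO A x y.
        inverse_elements A x y a (app (Antipode A x y) a)"
      and ext: "\<forall>x y. \<not> (x \<in> Pts A \<and> y \<in> Pts A) \<longrightarrow> Antipode A x y = undefined"
    interpret coalg_enriched_category SETS A "Pts A" "HomO A" "Mult A" "Eta A" "Comult A" "Counit A"
      by (rule A) simp_all
    show "hopf_category SETS A"
    proof
      fix x y assume xy: "x \<in> Pts A" "y \<in> Pts A"
      show S': "Antipode A x y \<in> homs SETS (HomO A x y) (HomO A y x)"
        using S xy by blast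
      show "Mult A x y x \<cdot>\<^bsub>SETS\<^esub> (\<one>\<^bsub>SETS\<^esub> (HomO A x y) \<odot>\<^bsub>SETS\<^esub> Antipode A x y) \<cdot>\<^bsub>SETS\<^esub> Comult A x y =
          Eta A x \<cdot>\<^bsub>SETS\<^esub> Counit A x y"
        and "Mult A y x y \<cdot>\<^bsub>SETS\<^esub> (Antipode A x y \<odot>\<^bsub>SETS\<^esub> \<one>\<^bsub>SETS\<^esub> (HomO A x y)) \<cdot>\<^bsub>SETS\<^esub> Comult A x y =
          Eta A y \<cdot>\<^bsub>SETS\<^esub> Counit A x y"
        using antipode[OF A xy S'] inv xy by blast+
    qed (use ext in blast)
  qed
qed

text \<open>An arrow from \<open>x\<close> to \<open>y\<close> is an element of
  \<open>HomO A y x\<close>, hence the exchanged indices on the right.\<close>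

lemma groupoid_ordinary_of_iff:
  assumes "enriched_category SETS A"
  shows "groupoid (ordinary_of A) \<longleftrightarrow>
    (\<forall>x\<in>Pts A. \<forall>y\<in>Pts A. \<forall>a\<in>HomO A y x. \<exists>b. inverse_elements A y x a b)"
proof -
  have "(\<exists>b. inverse_elements A y x a b) \<longleftrightarrow>
    (\<exists>b\<in>HomO A x y. app (Mult A x y x) (Tup b a) = app (Eta A x) Star \<and>
      app (Mult A y x y) (Tup a b) = app (Eta A y) Star)" for x y a
    by (auto simp: inverse_elements_def)
  then show ?thesis
    using ordinary_category_ordinary_of[OF assms]
    by (auto simp: groupoid_def groupoid_axioms_def)
qed

section \<open>Forgetting the antipode\<close>

lemma enriched_category_truncate:
  "enriched_category V (coalg_enriched_data.truncate A) \<longleftrightarrow> enriched_category V A"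
  by (simp add: enriched_category_def enriched_category_axioms_def coalg_enriched_data.defs)

text \<open>\<open>truncate\<close> keeps every field that the locale reads. The enriched part is
  rewritten before \<open>defs\<close> unfolds the truncation, while it still has the shape required
  by \<open>enriched_category_truncate\<close>.\<close>

lemma coalg_enriched_category_truncate:
  "coalg_enriched_category V (coalg_enriched_data.truncate A) \<longleftrightarrow> coalg_enriched_category V A"
  by (simp add: coalg_enriched_category_def coalg_enriched_category_axioms_def
      enriched_category_truncate) (simp add: coalg_enriched_data.defs)

lemma inverse_elements_truncate:
  "inverse_elements (coalg_enriched_data.truncate A) = inverse_elements A"
  by (simp add: fun_eq_iff inverse_elements_def coalg_enriched_data.defs)

text \<open>Injectivity is uniqueness of inverses; surjectivity comes from choosing an inverse of
  each element of a groupoid.\<close>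

lemma bij_betw_truncate:
  "bij_betw coalg_enriched_data.truncate
    {A :: ('x, 'a univ set, 'a univ setmap) hopf_data. hopf_category SETS A}
    {A. coalg_enriched_category SETS A \<and> groupoid (ordinary_of A)}"
proof (rule bij_betw_imageI)
  show "inj_on coalg_enriched_data.truncate
      {A :: ('x, 'a univ set, 'a univ setmap) hopf_data. hopf_category SETS A}"
  proof (rule inj_onI, clarify)
    fix A B :: "('x, 'a univ set, 'a univ setmap) hopf_data"
    assume A: "hopf_category SETS A" and B: "hopf_category SETS B"
      and eq: "coalg_enriched_data.truncate A = coalg_enriched_data.truncate B"
    have eqs: "Pts A = Pts B" "HomO A = HomO B" "Mult A = Mult B" "Eta A = Eta B"
      "Comult A = Comult B" "Counit A = Counit B"
      using eq by (simp_all add: coalg_enriched_data.defs)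
    have inv: "inverse_elements A = inverse_elements B"
      using inverse_elements_truncate[of A] inverse_elements_truncate[of B] eq by simp
    have E: "enriched_category SETS B"
      using B by (simp add: hopf_category_SETS_iff coalg_enriched_category_SETS_iff)
    \<comment> \<open>On objects both antipodes send each element to an inverse of it; elsewhere
      both are \<open>undefined\<close>.\<close>
    have "Antipode A x y = Antipode B x y" for x y
    proof (cases "x \<in> Pts B \<and> y \<in> Pts B")
      case True
      show ?thesis
      proof (rule homs_SETS_eqI)
        show "Antipode A x y \<in> homs SETS (HomO B x y) (HomO B y x)"
          "Antipode B x y \<in> homs SETS (HomO B x y) (HomO B y x)"
          using A B True eqs by (auto simp: hopf_category_SETS_iff)
        show "app (Antipode A x y) a = app (Antipode B x y) a" if "a \<in> HomO B x y" for a
          using A B True eqs inv that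
          by (intro inverse_elements_unique[OF E, of x y a]) (auto simp: hopf_category_SETS_iff)
      qed
    qed (use A B eqs in \<open>auto simp: hopf_category_SETS_iff\<close>)
    then show "A = B"
      using eqs by (intro hopf_data.equality) (auto simp: fun_eq_iff)
  qed
  show "coalg_enriched_data.truncate ` {A :: ('x, 'a univ set, 'a univ setmap) hopf_data. hopf_category SETS A}
    = {A. coalg_enriched_category SETS A \<and> groupoid (ordinary_of A)}" (is "?L = ?R")
  proof (intro equalityI subsetI)
    fix B assume "B \<in> ?L"
    then obtain A :: "('x, 'a univ set, 'a univ setmap) hopf_data"
      where A: "hopf_category SETS A" "B = coalg_enriched_data.truncate A" by blast
    then have B: "coalg_enriched_category SETS B"
      by (simp add: coalg_enriched_category_truncate hopf_category_SETS_iff)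
    then have "enriched_category SETS B"
      by (simp add: coalg_enriched_category_SETS_iff)
    moreover have "\<exists>b. inverse_elements B x y a b"
      if "x \<in> Pts B" "y \<in> Pts B" "a \<in> HomO B x y" for x y a
    proof -
      have "inverse_elements A x y a (app (Antipode A x y) a)"
        using A that by (simp add: hopf_category_SETS_iff coalg_enriched_data.defs)
      then show ?thesis
        unfolding A(2) inverse_elements_truncate by (rule exI)
    qed
    ultimately show "B \<in> ?R"
      using B by (simp add: groupoid_ordinary_of_iff)
  next
    fix B assume "B \<in> ?R"
    then have B: "coalg_enriched_category SETS B" "groupoid (ordinary_of B)" by auto
    \<comment> \<open>The antipode chooses an inverse of each element; the value
      \<open>undefined\<close> off the objects is the one demanded by
      \<open>antipode_ext\<close>.\<close>
    define S where "S = (\<lambda>x y. if x \<in> Pts B \<and> y \<in> Pts B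
      then mk_map (HomO B x y) (HomO B y x) (\<lambda>a. SOME b. inverse_elements B x y a b) else undefined)"
    define A :: "('x, 'a univ set, 'a univ setmap) hopf_data"
      where "A = coalg_enriched_data.extend B (hopf_data.fields S)"
    have trunc: "coalg_enriched_data.truncate A = B"
      by (simp add: A_def coalg_enriched_data.defs)
    have sel: "Pts A = Pts B" "HomO A = HomO B" "Antipode A = S"
      by (simp_all add: A_def coalg_enriched_data.defs hopf_data.defs)
    have ex: "inverse_elements B x y a (SOME b. inverse_elements B x y a b)"
      if "x \<in> Pts B" "y \<in> Pts B" "a \<in> HomO B x y" for x y a
      using B that
      by (intro someI_ex[of "inverse_elements B x y a"])
        (simp add: groupoid_ordinary_of_iff coalg_enriched_category_SETS_iff)
    have mem: "(SOME b. inverse_elements B x y a b) \<in> HomO B y x"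
      if "x \<in> Pts B" "y \<in> Pts B" "a \<in> HomO B x y" for x y a
      using ex[OF that] by (simp add: inverse_elements_def)
    have inv: "inverse_elements A = inverse_elements B"
      using inverse_elements_truncate[of A] trunc by simp
    have "coalg_enriched_category SETS A"
      using B(1) coalg_enriched_category_truncate[of SETS A] trunc by simp
    then have "hopf_category SETS A"
      unfolding hopf_category_SETS_iff sel inv by (auto simp: S_def ex mem)
    then show "B \<in> ?L" using trunc by blast
  qed
qed

theorem proposition2p5:
  shows "bij_betw ordinary_of
      {A :: ('x, 'a univ set, 'a univ setmap) coalg_enriched_data. coalg_enriched_category SETS A}
      {C :: ('x, 'a univ) cat_data. ordinary_category C}
    \<and> bij_betw (\<lambda>A. ordinary_of (coalg_enriched_data.truncate A))
      {A :: ('x, 'a univ set, 'a univ setmap) hopf_data. hopf_category SETS A}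
      {C :: ('x, 'a univ) cat_data. groupoid C}"
proof (intro conjI bij_betw_ordinary_of)
  \<comment> \<open>The first bijection is restricted to the preimage of the groupoids. A groupoid
    is an ordinary category by definition, so that conjunct is absorbed in the target.\<close>
  have "bij_betw ordinary_of
      {A :: ('x, 'a univ set, 'a univ setmap) coalg_enriched_data.
        coalg_enriched_category SETS A \<and> groupoid (ordinary_of A)}
      {C. groupoid C}"
    using bij_betw_Collect[OF bij_betw_ordinary_of, of groupoid "\<lambda>A. groupoid (ordinary_of A)"]
    by (simp add: groupoid_def conj_absorb cong: conj_cong)
  \<comment> \<open>Forgetting the unique antipode and then passing to the ordinary category
    composes the two bijections.\<close>
  from bij_betw_trans[OF bij_betw_truncate this]
  show "bij_betw (\<lambda>A. ordinary_of (coalg_enriched_data.truncate A))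
      {A :: ('x, 'a univ set, 'a univ setmap) hopf_data. hopf_category SETS A}
      {C :: ('x, 'a univ) cat_data. groupoid C}"
    by (simp add: comp_def)
qed

end
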